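(* Let $\Gamma$ be a finite simple connected graph with vertex set $V$, $n=|V|$, diameter $D\ge 1$ and largest eigenvalue $\lambda_0$. For $i\in\{D-1,D\}$ let $\delta_i^*=\frac1n\sum_{u\in V}\alpha_u^2\|\rho_{\Gamma_i(u)}\|^2$ be the arithmetic mean of the numbers $\alpha_u^2\|\rho_{\Gamma_i(u)}\|^2$ for $u\in V$. Suppose that $$\delta_D^*=p_{\ge D}(\lambda_0)\quad\text{and}\quad \delta_{D-1}^*=p_{D-1}(\lambda_0).$$ Then $\Gamma$ is distance-polynomial.
   Context: Let $\Gamma$ be a finite simple connected graph with vertex set $V$, $n=|V|$, diameter $D$, adjacency matrix $A$, and distinct eigenvalues $\lambda_0>\lambda_1>\cdots>\lambda_d$ with multiplicities $m(\lambda_i)$. Perron vector: $\alpha=(\alpha_u)_{u\in V}$ is the eigenvector of $A$ for $\lambda_0$ with all entries positive, normalized so that $\|\alpha\|^2=\sum_u\alpha_u^2=n$ (Euclidean norm). For a vertex $u$, let $e_u$ be the corresponding coordinate vector and $\Gamma_i(u)$ the set of vertices at distance exactly $i$ from $u$ (possibly empty). For $U\subseteq V$, $\rho_U=\sum_{v\in U}\alpha_v e_v$, so $\|\rho_U\|^2=\sum_{v\in U}\alpha_v^2$. Predistance polynomials: on real polynomials of degree at most $d$ consider the scalar product $\langle p,q\rangle_\Gamma=\frac1n\operatorname{tr}(p(A)q(A))=\frac1n\sum_{i=0}^d m(\lambda_i)p(\lambda_i)q(\lambda_i)$. The predistance polynomials $p_0,p_1,\ldots,p_d$ are the orthogonal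 polynomials with respect to this product, with $\deg p_i=i$, normalized so that $\|p_i\|_\Gamma^2=p_i(\lambda_0)$ (it is known that $p_i(\lambda_0)>0$). Put $p_{\ge D}=p_D+p_{D+1}+\cdots+p_d$ (note $D\le d$). The distance matrix $A_i$ ($0\le i\le D$) has $(A_i)_{uv}=1$ if $\mathrm{dist}(u,v)=i$ and $0$ otherwise. The graph $\Gamma$ is distance-polynomial if every distance matrix $A_i$, $0\le i\le D$, is a polynomial in $A$. *)

theory Defs
  imports "HOL-Analysis.Analysis" "HOL-Computational_Algebra.Polynomial"
begin

text \<open>
  A finite simple connected graph is an adjacency relation \<open>E\<close> on a finite type \<open>'v\<close>, whose
  universe is the whole vertex set; so \<open>n = CARD('v)\<close>.
\<close>

definition connected_simple_graph :: "('v::finite \<Rightarrow> 'v \<Rightarrow> bool) \<Rightarrow> bool" where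
  "connected_simple_graph E \<longleftrightarrow> symp E \<and> irreflp E \<and> (\<forall>u v. E\<^sup>*\<^sup>* u v)"

text \<open>\<open>(E ^^ k) u v\<close> says that there is a walk of length \<open>k\<close> from \<open>u\<close> to \<open>v\<close>; in a connected
  graph the least such \<open>k\<close> exists for all \<open>u\<close> and \<open>v\<close>.\<close>

definition gdist :: "('v::finite \<Rightarrow> 'v \<Rightarrow> bool) \<Rightarrow> 'v \<Rightarrow> 'v \<Rightarrow> nat" where
  "gdist E u v = (LEAST k. (E ^^ k) u v)"

definition gdiam :: "('v::finite \<Rightarrow> 'v \<Rightarrow> bool) \<Rightarrow> nat" where
  "gdiam E = Max {gdist E u v | u v. True}"

definition gsphere :: "('v::finite \<Rightarrow> 'v \<Rightarrow> bool) \<Rightarrow> nat \<Rightarrow> 'v \<Rightarrow> 'v set" where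
  "gsphere E i u = {v. gdist E u v = i}"

definition adj_mat :: "('v::finite \<Rightarrow> 'v \<Rightarrow> bool) \<Rightarrow> real^'v^'v" where
  "adj_mat E = (\<chi> u v. if E u v then 1 else 0)"

definition dist_mat :: "('v::finite \<Rightarrow> 'v \<Rightarrow> bool) \<Rightarrow> nat \<Rightarrow> real^'v^'v" where
  "dist_mat E i = (\<chi> u v. if gdist E u v = i then 1 else 0)"

text \<open>The type class power \<open>M ^ k\<close> on \<open>real^'n^'n\<close> is the entrywise power, so matrix powers
  are iterated products with \<open>**\<close>.\<close>

definition mat_pow :: "real^'n^'n \<Rightarrow> nat \<Rightarrow> real^'n^'n" where
  "mat_pow M k = (((**) M) ^^ k) (mat 1)"

definition poly_mat :: "real poly \<Rightarrow> real^'n^'n \<Rightarrow> real^'n^'n" where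
  "poly_mat p M = (\<Sum>k\<le>degree p. coeff p k *\<^sub>R mat_pow M k)"

definition eigvals :: "real^'n^'n \<Rightarrow> real set" where
  "eigvals M = {l. \<exists>x. x \<noteq> 0 \<and> M *v x = l *\<^sub>R x}"

text \<open>\<open>lambda0 E\<close> is the largest eigenvalue, and \<open>spec_d E\<close> is the number \<open>d\<close> such that the
  graph has \<open>d + 1\<close> distinct eigenvalues. The adjacency matrix is symmetric, so that all its
  eigenvalues are real.\<close>

definition lambda0 :: "('v::finite \<Rightarrow> 'v \<Rightarrow> bool) \<Rightarrow> real" where
  "lambda0 E = Max (eigvals (adj_mat E))"

definition spec_d :: "('v::finite \<Rightarrow> 'v \<Rightarrow> bool) \<Rightarrow> nat" where
  "spec_d E = card (eigvals (adj_mat E)) - 1"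

definition perron_vector :: "('v::finite \<Rightarrow> 'v \<Rightarrow> bool) \<Rightarrow> real^'v \<Rightarrow> bool" where
  "perron_vector E \<alpha> \<longleftrightarrow>
     adj_mat E *v \<alpha> = lambda0 E *\<^sub>R \<alpha> \<and> (\<forall>u. \<alpha> $ u > 0) \<and> (norm \<alpha>)\<^sup>2 = real CARD('v)"

definition rho :: "real^'v::finite \<Rightarrow> 'v set \<Rightarrow> real^'v" where
  "rho \<alpha> U = (\<Sum>v\<in>U. (\<alpha> $ v) *\<^sub>R axis v 1)"

definition delta_star :: "('v::finite \<Rightarrow> 'v \<Rightarrow> bool) \<Rightarrow> real^'v \<Rightarrow> nat \<Rightarrow> real" where
  "delta_star E \<alpha> i =
     (1 / real CARD('v)) * (\<Sum>u\<in>UNIV. (\<alpha> $ u)\<^sup>2 * (norm (rho \<alpha> (gsphere E i u)))\<^sup>2)"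

definition graph_inner :: "('v::finite \<Rightarrow> 'v \<Rightarrow> bool) \<Rightarrow> real poly \<Rightarrow> real poly \<Rightarrow> real" where
  "graph_inner E p q =
     (1 / real CARD('v)) * trace (poly_mat p (adj_mat E) ** poly_mat q (adj_mat E))"

text \<open>Only \<open>p 0, \<dots>, p d\<close> are constrained. The condition \<open>p i \<noteq> 0\<close> matters for \<open>i = 0\<close>: the zero
  polynomial has degree \<open>0\<close> here and would satisfy all the other conditions.\<close>

definition predistance_polys :: "('v::finite \<Rightarrow> 'v \<Rightarrow> bool) \<Rightarrow> (nat \<Rightarrow> real poly) \<Rightarrow> bool" where
  "predistance_polys E p \<longleftrightarrow>
     (\<forall>i\<le>spec_d E. p i \<noteq> 0 \<and> degree (p i) = i) \<and>
     (\<forall>i\<le>spec_d E. \<forall>j\<le>spec_d E. i \<noteq> j \<longrightarrow> graph_inner E (p i) (p j) = 0) \<and>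
     (\<forall>i\<le>spec_d E. graph_inner E (p i) (p i) = poly (p i) (lambda0 E))"

definition distance_polynomial :: "('v::finite \<Rightarrow> 'v \<Rightarrow> bool) \<Rightarrow> bool" where
  "distance_polynomial E \<longleftrightarrow> (\<forall>i\<le>gdiam E. \<exists>q. dist_mat E i = poly_mat q (adj_mat E))"

end

theory Submission
  imports Defs
begin

text \<open>
  Write \<open>D\<close> for the diameter, \<open>d + 1\<close> for the number of eigenvalues, \<open>p\<^bsub>\<ge>k\<^esub> = p\<^sub>k + \<dots> + p\<^sub>d\<close>, and
  \<open>A\<^sup>*\<^sub>i\<close> for the matrix with entry \<open>\<alpha>\<^sub>u \<alpha>\<^sub>v\<close> at pairs at distance \<open>i\<close> and \<open>0\<close> elsewhere, whose
  squared norm for \<open>\<langle>M, N\<rangle> = tr(M N\<^sup>T) / n\<close> is \<open>\<delta>\<^sup>*\<^sub>i\<close>. The sum of all \<open>p\<^sub>i\<close> is the Hoffman polynomial: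
  evaluated at \<open>A\<close> it is \<open>\<alpha> \<alpha>\<^sup>T\<close> (lemma \<open>poly_mat_head_all\<close>). As \<open>p\<^sub>0 + \<dots> + p\<^bsub>k-1\<^esub>\<close> has degree less than
  \<open>k\<close>, its matrix vanishes at distance \<open>k\<close> or more. Hence \<open>p\<^bsub>\<ge>k\<^esub>(A)\<close> agrees with \<open>\<alpha> \<alpha>\<^sup>T\<close> at
  those pairs.

  In particular \<open>p\<^bsub>\<ge>D\<^esub>(A)\<close> agrees with \<open>A\<^sup>*\<^sub>D\<close> on the support of the latter. Its squared norm is
  \<open>p\<^bsub>\<ge>D\<^esub>(\<lambda>\<^sub>0)\<close>, so the first hypothesis says that both matrices have the same norm and therefore are
  equal. It follows that \<open>p\<^bsub>D-1\<^esub>(A)\<close> agrees with \<open>A\<^sup>*\<^bsub>D-1\<^esub>\<close> on the support of the latter, and the second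
  hypothesis makes these two equal as well (lemma \<open>poly_mat_eq_weight_on_sphere\<close>, used twice).

  From here the structure propagates downwards. The polynomial \<open>(x - \<lambda>\<^sub>0)(p\<^sub>0 + \<dots> + p\<^sub>i)\<close> is a
  combination \<open>b p\<^sub>i + c p\<^bsub>i+1\<^esub>\<close> with \<open>b \<noteq> 0\<close> (lemma \<open>head_recurrence\<close>). Because
  \<open>(A - \<lambda>\<^sub>0) \<alpha> \<alpha>\<^sup>T = 0\<close>, its matrix is also \<open>- (A - \<lambda>\<^sub>0) p\<^bsub>\<ge>i+1\<^esub>(A)\<close>. If \<open>p\<^bsub>\<ge>i+1\<^esub>(A)\<close> and
  \<open>p\<^bsub>i+1\<^esub>(A)\<close> vanish at all distances less than \<open>i + 1\<close>, then \<open>p\<^sub>i(A)\<close> vanishes at all distances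
  less than \<open>i\<close> (lemma \<open>far_supported_descent\<close>), and so does \<open>p\<^bsub>\<ge>i\<^esub>(A)\<close>. Starting at
  \<open>i = D - 1\<close>, this reaches \<open>i = 0\<close>.

  At the bottom the diagonal of \<open>p\<^bsub>\<ge>1\<^esub>(A)\<close> is zero, so the diagonal of \<open>\<alpha> \<alpha>\<^sup>T\<close> is that of the scalar
  matrix \<open>p\<^sub>0(A)\<close>. Thus \<open>\<alpha>\<close> is constant \<open>1\<close>, the weights disappear, and each distance matrix is a
  difference of two consecutive \<open>p\<^bsub>\<ge>k\<^esub>(A)\<close>, or \<open>p\<^bsub>\<ge>D\<^esub>(A)\<close> itself.
\<close>

section \<open>Polynomials of a real matrix\<close>

lemma poly_mat_eq_sum:
  assumes "degree p \<le> N"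
  shows "poly_mat p M = (\<Sum>k\<le>N. coeff p k *\<^sub>R mat_pow M k)"
  unfolding poly_mat_def
  by (rule sum.mono_neutral_left) (use assms in \<open>auto simp: coeff_eq_0\<close>)

lemma mat_pow_0 [simp]: "mat_pow M 0 = mat 1"
  and mat_pow_Suc: "mat_pow M (Suc k) = M ** mat_pow M k"
  by (simp_all add: mat_pow_def)

lemma poly_mat_0 [simp]: "poly_mat 0 M = 0"
  by (simp add: poly_mat_def)

lemma matrix_mult_sum_right:
  fixes M :: "real^'n^'n"
  shows "M ** (\<Sum>i\<in>I. F i) = (\<Sum>i\<in>I. M ** F i)"
  by (induction I rule: infinite_finite_induct) (auto simp: matrix_add_ldistrib)

lemma poly_mat_pCons: "poly_mat (pCons a p) M = a *\<^sub>R mat 1 + M ** poly_mat p M"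
proof -
  have "poly_mat (pCons a p) M = (\<Sum>k\<le>Suc (degree p). coeff (pCons a p) k *\<^sub>R mat_pow M k)"
    by (rule poly_mat_eq_sum) (simp add: degree_pCons_le)
  also have "\<dots> = a *\<^sub>R mat 1 + (\<Sum>k\<le>degree p. coeff p k *\<^sub>R (M ** mat_pow M k))"
    by (simp only: sum.atMost_Suc_shift) (simp add: mat_pow_Suc)
  also have "(\<Sum>k\<le>degree p. coeff p k *\<^sub>R (M ** mat_pow M k)) = M ** poly_mat p M"
    by (simp add: poly_mat_def matrix_mult_sum_right matrix_scalar_ac scalar_matrix_assoc)
  finally show ?thesis .
qed

lemma poly_mat_add: "poly_mat (p + q) M = poly_mat p M + poly_mat q M"
proof -
  define N where "N = max (degree p) (degree q)"
  have "degree (p + q) \<le> N" "degree p \<le> N" "degree q \<le> N"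
    using degree_add_le_max[of p q] by (auto simp: N_def)
  then show ?thesis
    by (simp add: poly_mat_eq_sum scaleR_add_left sum.distrib)
qed

lemma poly_mat_smult: "poly_mat (smult c p) M = c *\<^sub>R poly_mat p M"
  using poly_mat_eq_sum[of "smult c p" "degree p" M]
  by (simp add: poly_mat_def scaleR_sum_right degree_smult_le)

lemma poly_mat_diff: "poly_mat (p - q) M = poly_mat p M - poly_mat q M"
proof -
  have "p - q = p + smult (- 1) q" by simp
  then show ?thesis by (simp only: poly_mat_add poly_mat_smult) simp
qed

lemma matrix_add_rdistrib:
  fixes A B C :: "real^'n^'n"
  shows "(A + B) ** C = A ** C + B ** C"
  by (vector matrix_matrix_mult_def sum.distrib[symmetric] field_simps)

lemma poly_mat_mult: "poly_mat (p * q) M = poly_mat p M ** poly_mat q M"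
proof (induction p)
  case 0
  show ?case by (simp add: matrix_matrix_mult_def vec_eq_iff)
next
  case (pCons a p)
  have "poly_mat (pCons a p * q) M = a *\<^sub>R poly_mat q M + M ** (poly_mat p M ** poly_mat q M)"
    by (simp add: poly_mat_add poly_mat_smult poly_mat_pCons pCons.IH)
  also have "\<dots> = poly_mat (pCons a p) M ** poly_mat q M"
    by (simp add: poly_mat_pCons matrix_add_rdistrib matrix_mul_assoc
        flip: scalar_matrix_assoc)
  finally show ?case .
qed

lemma matrix_mult_0_right [simp]: "(M :: real^'n^'n) ** 0 = 0"
  by (simp add: matrix_matrix_mult_def vec_eq_iff)

lemma poly_mat_linear: "poly_mat [:c, 1:] M = M + c *\<^sub>R mat 1"
  by (simp add: poly_mat_pCons add.commute)

lemma poly_mat_commute: "M ** poly_mat q M = poly_mat q M ** M"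
proof -
  have "poly_mat [:0, 1:] M = M" by (simp add: poly_mat_linear)
  then show ?thesis by (metis mult.commute poly_mat_mult)
qed

lemma poly_mat_eigenvector:
  assumes "M *v x = l *\<^sub>R x"
  shows "poly_mat p M *v x = poly p l *\<^sub>R x"
proof (induction p)
  case (pCons a p)
  have "poly_mat (pCons a p) M *v x = a *\<^sub>R x + M *v (poly_mat p M *v x)"
    by (simp add: poly_mat_pCons matrix_vector_mult_add_rdistrib matrix_vector_mul_assoc
        flip: scaleR_matrix_vector_assoc)
  then show ?case
    by (simp add: pCons.IH matrix_vector_mult_scaleR assms algebra_simps)
qed simp

lemma transpose_poly_mat:
  assumes "transpose M = M"
  shows "transpose (poly_mat p M) = poly_mat p M"
proof -
  have add: "transpose (B + C) = transpose B + transpose C" for B C :: "real^'a^'a"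
    by (simp add: transpose_def vec_eq_iff)
  show ?thesis
  proof (induction p)
    case 0
    show ?case by (simp add: transpose_def vec_eq_iff)
  next
    case (pCons a p)
    then show ?case
      by (simp add: poly_mat_pCons add transpose_scalar matrix_transpose_mul assms poly_mat_commute)
  qed
qed

lemma trace_mult_symmetric:
  fixes M :: "real^'n^'n"
  assumes "transpose M = M"
  shows "trace (M ** M) = (\<Sum>u\<in>UNIV. \<Sum>v\<in>UNIV. (M$u$v)\<^sup>2)"
proof -
  have "M$v$u = M$u$v" for u v
    using assms by (metis (no_types, lifting) transpose_def vec_lambda_beta)
  then show ?thesis
    by (simp add: trace_def matrix_matrix_mult_def power2_eq_square)
qed

section \<open>The spectrum of a real symmetric matrix\<close>

lemma symmetric_inner:
  fixes M :: "real^'n^'n"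
  assumes "transpose M = M"
  shows "(M *v x) \<bullet> y = x \<bullet> (M *v y)"
  by (metis assms dot_lmul_matrix transpose_matrix_vector)

text \<open>A maximiser \<open>x\<close> of the Rayleigh quotient on the unit sphere of \<open>W\<close>, with maximum \<open>l\<close>, is an
  eigenvector. The residual \<open>y = l x - M x\<close> lies in \<open>W\<close> again, and the form of \<open>l - M\<close> at
  \<open>x - t y\<close> is \<open>- 2 t \<parallel>y\<parallel>\<^sup>2 + O(t\<^sup>2)\<close>. As the form is nonnegative on \<open>W\<close>, \<open>y\<close> must vanish.\<close>

lemma symmetric_eigenvector_in_invariant_subspace:
  fixes M :: "real^'n^'n"
  assumes sym: "transpose M = M" and W: "subspace W" and inv: "\<And>x. x \<in> W \<Longrightarrow> M *v x \<in> W"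
    and w: "w \<in> W" "w \<noteq> 0"
  obtains x l where "x \<in> W" "x \<noteq> 0" "M *v x = l *\<^sub>R x"
proof -
  define R where "R = (\<lambda>x. x \<bullet> (M *v x))"
  define S where "S = W \<inter> sphere 0 1"
  have "compact S"
    unfolding S_def by (intro closed_Int_compact closed_subspace W compact_sphere)
  moreover have "(1 / norm w) *\<^sub>R w \<in> S"
    using w W by (auto simp: S_def subspace_scale)
  moreover have "continuous_on S R"
    unfolding R_def by (intro continuous_intros linear_continuous_on matrix_vector_mul_bounded_linear)
  ultimately obtain x where x: "x \<in> S" and max: "\<And>y. y \<in> S \<Longrightarrow> R y \<le> R x"
    using continuous_attains_sup[of S R] by blast
  have xW: "x \<in> W" and xx: "x \<bullet> x = 1"
    using x by (auto simp: S_def norm_eq_1)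
  define l where "l = R x"
  \<comment> \<open>The quadratic form of \<open>l - M\<close> is nonnegative on \<open>W\<close> and vanishes at \<open>x\<close>.\<close>
  have psd: "0 \<le> l * (y \<bullet> y) - R y" if "y \<in> W" for y
  proof (cases "y = 0")
    case True
    then show ?thesis by (simp add: R_def)
  next
    case False
    then have "(1 / norm y) *\<^sub>R y \<in> S"
      using that W by (auto simp: S_def subspace_scale)
    from max[OF this] have "R y / (norm y)\<^sup>2 \<le> l"
      by (simp add: R_def l_def matrix_vector_mult_scaleR power2_eq_square)
    with False show ?thesis
      by (simp add: divide_le_eq power2_norm_eq_inner)
  qed
  define y where "y = l *\<^sub>R x - M *v x"
  have yW: "y \<in> W"
    unfolding y_def by (intro subspace_diff subspace_scale W xW inv)
  define C where "C = l * (y \<bullet> y) - R y"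
  have quad: "0 \<le> - 2 * t * (y \<bullet> y) + t\<^sup>2 * C" for t
  proof -
    have "0 \<le> l * ((x - t *\<^sub>R y) \<bullet> (x - t *\<^sub>R y)) - R (x - t *\<^sub>R y)"
      by (intro psd subspace_diff subspace_scale W xW yW)
    also have "\<dots> = (l - R x) - 2 * t * (l * (x \<bullet> y) - (M *v x) \<bullet> y) + t\<^sup>2 * C"
      using symmetric_inner[OF sym, of x y]
      by (simp add: R_def C_def xx inner_diff_left inner_diff_right matrix_vector_mult_diff_distrib
          matrix_vector_mult_scaleR inner_commute[of "M *v x"] inner_commute[of y x]
          algebra_simps power2_eq_square)
    also have "l * (x \<bullet> y) - (M *v x) \<bullet> y = y \<bullet> y"
      by (simp add: y_def inner_diff_left)
    finally show ?thesis by (simp add: l_def)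
  qed
  have "y \<bullet> y = 0"
  proof (rule ccontr)
    assume "y \<bullet> y \<noteq> 0"
    then have pos: "y \<bullet> y > 0" by simp
    \<comment> \<open>So short a step that the linear term dominates; the \<open>1\<close> covers the case \<open>C = 0\<close>.\<close>
    define t where "t = (y \<bullet> y) / (\<bar>C\<bar> + 1)"
    have "t > 0" using pos by (simp add: t_def add_nonneg_pos)
    have "t * C \<le> t * (\<bar>C\<bar> + 1)"
      using \<open>t > 0\<close> by (intro mult_left_mono) auto
    also have "\<dots> = y \<bullet> y" by (simp add: t_def add_nonneg_eq_0_iff)
    finally have "t * (t * C) \<le> t * (y \<bullet> y)"
      using \<open>t > 0\<close> by (intro mult_left_mono) auto
    then have "- 2 * t * (y \<bullet> y) + t\<^sup>2 * C \<le> - (t * (y \<bullet> y))"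
      by (simp add: power2_eq_square algebra_simps)
    also have "\<dots> < 0" using \<open>t > 0\<close> pos by simp
    finally show False using quad[of t] by simp
  qed
  then have "M *v x = l *\<^sub>R x" by (simp add: y_def)
  moreover have "x \<noteq> 0" using xx by auto
  ultimately show ?thesis using xW that by blast
qed

text \<open>Eigenvectors of distinct eigenvalues are orthogonal, and a Euclidean space contains only finitely
  many pairwise orthogonal nonzero vectors.\<close>

lemma finite_eigvals_symmetric:
  fixes M :: "real^'n^'n"
  assumes sym: "transpose M = M"
  shows "finite (eigvals M)"
proof -
  define f where "f l = (SOME x. x \<noteq> 0 \<and> M *v x = l *\<^sub>R x)" for l
  have f: "f l \<noteq> 0 \<and> M *v f l = l *\<^sub>R f l" if "l \<in> eigvals M" for l
    unfolding f_def by (rule someI_ex) (use that in \<open>simp add: eigvals_def\<close>)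
  have orth: "orthogonal (f k) (f l)" if "k \<in> eigvals M" "l \<in> eigvals M" "k \<noteq> l" for k l
    using symmetric_inner[OF sym, of "f k" "f l"] f that by (auto simp: orthogonal_def)
  have "inj_on f (eigvals M)"
    using orth f by (metis inj_onI orthogonal_self)
  moreover have "pairwise orthogonal (f ` eigvals M)"
    using orth by (auto simp: pairwise_def)
  ultimately show ?thesis
    using pairwise_orthogonal_imp_finite finite_imageD by blast
qed

definition spectral_poly :: "real set \<Rightarrow> real poly" where
  "spectral_poly S = (\<Prod>l\<in>S. [:- l, 1:])"

lemma degree_spectral_poly: "degree (spectral_poly S) = card S"
  by (cases "finite S") (simp_all add: spectral_poly_def degree_prod_eq_sum_degree)

lemma poly_spectral_poly_eq_0_iff:
  "finite S \<Longrightarrow> poly (spectral_poly S) l = 0 \<longleftrightarrow> l \<in> S"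
  by (auto simp: spectral_poly_def poly_prod)

lemma matrix_eq_0I:
  fixes M :: "real^'n^'m"
  assumes "\<And>x. M *v x = 0"
  shows "M = 0"
  using assms by (simp add: matrix_eq)

text \<open>Were \<open>m(M)\<close> nonzero for \<open>m\<close> the product of \<open>x - l\<close> over all eigenvalues \<open>l\<close>, its range would contain an
  eigenvector \<open>m(M)v\<close>. But \<open>m(M)\<close> kills every eigenvector, and \<open>m(M)\<^sup>2 v = 0\<close> forces \<open>m(M)v = 0\<close>
  by symmetry.\<close>

lemma poly_mat_spectral_poly_eigvals:
  fixes M :: "real^'n^'n"
  assumes sym: "transpose M = M"
  shows "poly_mat (spectral_poly (eigvals M)) M = 0"
proof (rule matrix_eq_0I, rule ccontr)
  define m where "m = poly_mat (spectral_poly (eigvals M)) M"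
  fix w
  assume w: "poly_mat (spectral_poly (eigvals M)) M *v w \<noteq> 0"
  have sub: "subspace (range ((*v) m))"
    by (intro linear_subspace_image) auto
  have inv: "M *v x \<in> range ((*v) m)" if x: "x \<in> range ((*v) m)" for x
  proof -
    from x obtain v where "x = m *v v" by auto
    then have "M *v x = m *v (M *v v)"
      by (simp add: matrix_vector_mul_assoc poly_mat_commute m_def)
    then show ?thesis by auto
  qed
  obtain x l where x: "x \<in> range ((*v) m)" "x \<noteq> 0" "M *v x = l *\<^sub>R x"
    using symmetric_eigenvector_in_invariant_subspace[OF sym sub inv, of "m *v w"] w
    by (auto simp: m_def)
  then obtain v where v: "x = m *v v" by auto
  have "l \<in> eigvals M" using x by (auto simp: eigvals_def)
  then have "m *v x = 0"
    using poly_mat_eigenvector[OF x(3)]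
    by (simp add: m_def poly_spectral_poly_eq_0_iff finite_eigvals_symmetric sym)
  then have "x \<bullet> x = 0"
    using symmetric_inner[of m v "m *v v"] transpose_poly_mat[OF sym] by (simp add: v m_def)
  with x show False by simp
qed

section \<open>Walks and the support of matrix polynomials\<close>

lemma gdist_le_walk:
  fixes E :: "'v::finite \<Rightarrow> 'v \<Rightarrow> bool" and k :: nat
  assumes "(E ^^ k) u v"
  shows "gdist E u v \<le> k"
  using assms
  unfolding gdist_def by (rule Least_le)

lemma walk_gdist:
  assumes "connected_simple_graph E"
  shows "(E ^^ gdist E u v) u v"
proof -
  have "\<exists>k. (E ^^ k) u v"
    using assms by (simp add: connected_simple_graph_def rtranclp_power)
  then show ?thesis unfolding gdist_def by (rule LeastI_ex)
qed

lemma gdist_neighbour: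
  assumes "connected_simple_graph E" "E u w"
  shows "gdist E u v \<le> Suc (gdist E w v)"
  by (rule gdist_le_walk) (use assms walk_gdist in \<open>blast intro: relpowp_Suc_I2\<close>)

lemma gdist_eq_0_iff:
  assumes "connected_simple_graph E"
  shows "gdist E u v = 0 \<longleftrightarrow> u = v"
  using walk_gdist[OF assms, of u v] gdist_le_walk[of 0 E u v] by auto

lemma finite_gdists: "finite {gdist E u v | u v. True}"
proof -
  have "{gdist E u v | u v. True} = (\<lambda>(u, v). gdist E u v) ` UNIV" by auto
  then show ?thesis by simp
qed

lemma gdist_le_gdiam: "gdist E u v \<le> gdiam E"
  unfolding gdiam_def by (rule Max_ge[OF finite_gdists]) auto

lemma gdiam_attained: "\<exists>u v. gdist E u v = gdiam E"
proof -
  have "gdiam E \<in> {gdist E u v | u v. True}"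
    unfolding gdiam_def by (rule Max_in[OF finite_gdists]) auto
  then show ?thesis by (auto dest: sym)
qed

lemma transpose_adj_mat:
  "connected_simple_graph E \<Longrightarrow> transpose (adj_mat E) = adj_mat E"
  by (auto simp: connected_simple_graph_def transpose_def adj_mat_def vec_eq_iff dest: sympD)

lemma mat_pow_adj_mat_nonzero:
  "mat_pow (adj_mat E) k $ u $ v \<noteq> 0 \<Longrightarrow> (E ^^ k) u v"
proof (induction k arbitrary: u)
  case 0
  then show ?case by (simp add: mat_def split: if_splits)
next
  case (Suc k)
  from Suc.prems obtain w where "adj_mat E $ u $ w * mat_pow (adj_mat E) k $ w $ v \<noteq> 0"
    by (auto simp: mat_pow_Suc matrix_matrix_mult_def elim: sum.not_neutral_contains_not_neutral)
  then have "E u w" "(E ^^ k) w v"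
    using Suc.IH by (auto simp: adj_mat_def split: if_splits)
  then show ?case by (rule relpowp_Suc_I2)
qed

text \<open>The entry of \<open>A\<^sup>k\<close> at \<open>(u, v)\<close> counts walks of length \<open>k\<close>, of which there are none for
  \<open>k\<close> below the distance. So a polynomial of degree \<open>k\<close> in \<open>A\<close> cannot see pairs at distance
  above \<open>k\<close>.\<close>

lemma poly_mat_adj_mat_far:
  assumes "degree q < gdist E u v"
  shows "poly_mat q (adj_mat E) $ u $ v = 0"
proof -
  have "mat_pow (adj_mat E) k $ u $ v = 0" if "k \<le> degree q" for k
    using mat_pow_adj_mat_nonzero[of E k u v] gdist_le_walk[of k E u v] that assms by fastforce
  then show ?thesis by (simp add: poly_mat_def)
qed

text \<open>The opposite localisation, which no degree bound provides: the matrix vanishes at all pairs at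
  distance less than \<open>k\<close>. The proof carries it from the diameter down to smaller \<open>k\<close>, losing
  one unit of distance for each factor \<open>A\<close>.\<close>

definition far_supported :: "('v::finite \<Rightarrow> 'v \<Rightarrow> bool) \<Rightarrow> nat \<Rightarrow> real^'v^'v \<Rightarrow> bool" where
  "far_supported E k M \<longleftrightarrow> (\<forall>u v. gdist E u v < k \<longrightarrow> M $ u $ v = 0)"

lemma far_supported_mono: "far_supported E k M \<Longrightarrow> j \<le> k \<Longrightarrow> far_supported E j M"
  by (auto simp: far_supported_def)

lemma far_supported_add:
  "far_supported E k M \<Longrightarrow> far_supported E k N \<Longrightarrow> far_supported E k (M + N)"
  by (auto simp: far_supported_def)

lemma far_supported_diff:
  "far_supported E k M \<Longrightarrow> far_supported E k N \<Longrightarrow> far_supported E k (M - N)"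
  by (auto simp: far_supported_def)

lemma far_supported_scaleR: "far_supported E k M \<Longrightarrow> far_supported E k (c *\<^sub>R M)"
  by (auto simp: far_supported_def)

lemma far_supported_scaleR_iff:
  "c \<noteq> 0 \<Longrightarrow> far_supported E k (c *\<^sub>R M) \<longleftrightarrow> far_supported E k M"
  by (auto simp: far_supported_def)

lemma far_supported_adj_mat_mult:
  assumes "connected_simple_graph E" "far_supported E (Suc k) M"
  shows "far_supported E k (adj_mat E ** M)"
  unfolding far_supported_def
proof (intro allI impI)
  fix u v assume lt: "gdist E u v < k"
  have "adj_mat E $ u $ w * M $ w $ v = 0" for w
  proof (cases "E u w")
    case True
    then have "E w u" using assms(1) by (auto simp: connected_simple_graph_def dest: sympD)
    from gdist_neighbour[OF assms(1) this, of v] lt assms(2) show ?thesis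
      by (auto simp: far_supported_def)
  qed (simp add: adj_mat_def)
  then show "(adj_mat E ** M) $ u $ v = 0"
    by (simp only: matrix_matrix_mult_def vec_lambda_beta sum.neutral_const)
qed

section \<open>The Perron vector and the Hoffman polynomial\<close>

lemma finite_eigvals_adj_mat: "connected_simple_graph E \<Longrightarrow> finite (eigvals (adj_mat E))"
  by (intro finite_eigvals_symmetric transpose_adj_mat)

lemma perron_vectorD:
  fixes \<alpha> :: "real^'v::finite"
  assumes "perron_vector E \<alpha>"
  shows "adj_mat E *v \<alpha> = lambda0 E *\<^sub>R \<alpha>" "\<alpha> $ u > 0" "\<alpha> \<bullet> \<alpha> = real CARD('v)"
  using assms by (auto simp: perron_vector_def power2_norm_eq_inner)

lemma lambda0_in_eigvals:
  assumes "perron_vector E \<alpha>"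
  shows "lambda0 E \<in> eigvals (adj_mat E)"
proof -
  have "\<alpha> \<noteq> 0" using perron_vectorD(3)[OF assms] by auto
  with perron_vectorD(1)[OF assms] show ?thesis by (auto simp: eigvals_def)
qed

lemma card_eigvals_adj_mat:
  assumes "connected_simple_graph E" "perron_vector E \<alpha>"
  shows "card (eigvals (adj_mat E)) = Suc (spec_d E)"
proof -
  have "card (eigvals (adj_mat E)) > 0"
    using finite_eigvals_adj_mat[OF assms(1)] lambda0_in_eigvals[OF assms(2)]
    by (auto simp: card_gt_0_iff)
  then show ?thesis by (simp add: spec_d_def)
qed

text \<open>Simplicity of \<open>\<lambda>\<^sub>0\<close>. For the largest ratio \<open>t\<close> of \<open>x\<close> to \<open>\<alpha>\<close>, the eigenvector \<open>t \<alpha> - x\<close> is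
  nonnegative with a zero entry. The eigenvalue equation at a zero entry is a vanishing sum of
  nonnegative terms, so the zero spreads to the neighbours and by connectivity to all vertices.\<close>

lemma perron_eigenspace:
  fixes E :: "'v::finite \<Rightarrow> 'v \<Rightarrow> bool"
  assumes G: "connected_simple_graph E" and P: "perron_vector E \<alpha>"
    and x: "adj_mat E *v x = lambda0 E *\<^sub>R x"
  obtains t where "x = t *\<^sub>R \<alpha>"
proof -
  define t where "t = Max (range (\<lambda>u. x $ u / \<alpha> $ u))"
  define y where "y = t *\<^sub>R \<alpha> - x"
  have pos: "\<alpha> $ u > 0" for u using perron_vectorD(2)[OF P] .
  have "t \<in> range (\<lambda>u. x $ u / \<alpha> $ u)"
    unfolding t_def by (rule Max_in) auto
  then obtain u0 where "t = x $ u0 / \<alpha> $ u0" by auto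
  then have u0: "y $ u0 = 0"
    using pos[of u0] by (simp add: y_def)
  have "x $ u / \<alpha> $ u \<le> t" for u
    unfolding t_def by (rule Max_ge) auto
  then have y_ge: "y $ u \<ge> 0" for u
    using pos[of u] by (simp add: y_def flip: pos_divide_le_eq)
  have eig: "adj_mat E *v y = lambda0 E *\<^sub>R y"
    using perron_vectorD(1)[OF P] x
    by (simp add: y_def matrix_vector_mult_diff_distrib matrix_vector_mult_scaleR algebra_simps)
  have step: "y $ w = 0" if "y $ u = 0" "E u w" for u w
  proof -
    have "(\<Sum>v\<in>UNIV. adj_mat E $ u $ v * y $ v) = (adj_mat E *v y) $ u"
      by (simp add: matrix_vector_mult_def)
    also have "\<dots> = 0" using that by (simp add: eig)
    finally have "\<forall>v\<in>UNIV. adj_mat E $ u $ v * y $ v = 0"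
      by (subst (asm) sum_nonneg_eq_0_iff) (auto simp: y_ge adj_mat_def)
    then have "adj_mat E $ u $ w * y $ w = 0" by blast
    then show ?thesis using that by (simp add: adj_mat_def)
  qed
  have "y $ w = 0" for w
  proof -
    have "E\<^sup>*\<^sup>* u0 w" using G by (simp add: connected_simple_graph_def)
    then show ?thesis by (induction rule: rtranclp_induct) (auto simp: u0 step)
  qed
  then have "y = 0" by (simp add: vec_eq_iff)
  then have "x = t *\<^sub>R \<alpha>" by (simp add: y_def)
  then show ?thesis by (rule that)
qed

definition weight_mat :: "real^'v \<Rightarrow> real^'v^'v" where
  "weight_mat \<alpha> = (\<chi> u v. \<alpha> $ u * \<alpha> $ v)"

lemma mult_weight_mat: "(M ** weight_mat \<alpha>) $ u $ v = (M *v \<alpha>) $ u * \<alpha> $ v"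
  by (simp add: weight_mat_def matrix_matrix_mult_def matrix_vector_mult_def sum_distrib_right
      mult.assoc)

lemma trace_weight_mat: "trace (weight_mat \<alpha>) = \<alpha> \<bullet> \<alpha>"
  by (simp add: trace_def weight_mat_def inner_vec_def)

lemma poly_mat_mult_weight_mat:
  assumes "perron_vector E \<alpha>"
  shows "poly_mat q (adj_mat E) ** weight_mat \<alpha> = poly q (lambda0 E) *\<^sub>R weight_mat \<alpha>"
  by (simp add: vec_eq_iff mult_weight_mat poly_mat_eigenvector[OF perron_vectorD(1)[OF assms]])
     (simp add: weight_mat_def)

text \<open>Let \<open>g\<close> be the product of \<open>x - l\<close> over the eigenvalues \<open>l\<close> other than \<open>\<lambda>\<^sub>0\<close>. Since
  \<open>(A - \<lambda>\<^sub>0) g(A) = 0\<close>, the range of \<open>g(A)\<close> lies in the eigenspace spanned by \<open>\<alpha>\<close>. A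
  symmetric matrix with this range is a multiple of \<open>\<alpha> \<alpha>\<^sup>T\<close>, and the multiple is nonzero because
  \<open>g(\<lambda>\<^sub>0) \<noteq> 0\<close>.\<close>

lemma Hoffman_polynomial_exists:
  fixes E :: "'v::finite \<Rightarrow> 'v \<Rightarrow> bool"
  assumes G: "connected_simple_graph E" and P: "perron_vector E \<alpha>"
  obtains h where "degree h \<le> spec_d E" "poly_mat h (adj_mat E) = weight_mat \<alpha>"
proof -
  define A where "A = adj_mat E"
  define l where "l = lambda0 E"
  define g where "g = spectral_poly (eigvals A - {l})"
  note fin = finite_eigvals_adj_mat[OF G, folded A_def]
  note lam = lambda0_in_eigvals[OF P, folded A_def l_def]
  have symg: "transpose (poly_mat g A) = poly_mat g A"
    by (intro transpose_poly_mat) (simp add: A_def transpose_adj_mat G)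
  have "spectral_poly (eigvals A) = [:- l, 1:] * g"
    unfolding spectral_poly_def g_def by (rule prod.remove[OF fin lam])
  with poly_mat_spectral_poly_eigvals[of A] have 0: "poly_mat [:- l, 1:] A ** poly_mat g A = 0"
    by (simp only: A_def transpose_adj_mat G flip: poly_mat_mult)
  have "\<exists>c. poly_mat g A *v x = c *\<^sub>R \<alpha>" for x
  proof -
    have "A *v (poly_mat g A *v x) - l *\<^sub>R (poly_mat g A *v x)
        = (poly_mat [:- l, 1:] A ** poly_mat g A) *v x"
      by (simp add: poly_mat_linear matrix_vector_mult_diff_rdistrib
          flip: matrix_vector_mul_assoc scaleR_matrix_vector_assoc)
    then have "A *v (poly_mat g A *v x) = l *\<^sub>R (poly_mat g A *v x)"
      by (simp add: 0)
    from perron_eigenspace[OF G P this[unfolded A_def l_def]] show ?thesis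
      by (metis A_def)
  qed
  then obtain c where c: "\<And>x. poly_mat g A *v x = c x *\<^sub>R \<alpha>" by metis
  define n where "n = real CARD('v)"
  have n: "n > 0" "\<alpha> \<bullet> \<alpha> = n" using perron_vectorD(3)[OF P] by (simp_all add: n_def)
  have ev: "poly_mat g A *v \<alpha> = poly g l *\<^sub>R \<alpha>"
    using perron_vectorD(1)[OF P] by (intro poly_mat_eigenvector) (simp add: A_def l_def)
  \<comment> \<open>The scalar is determined by pairing with \<open>\<alpha>\<close> and moving \<open>g(A)\<close> across.\<close>
  have cx: "c x * n = poly g l * (\<alpha> \<bullet> x)" for x
    using symmetric_inner[OF symg, of \<alpha> x] ev c[of x] n by simp
  have g0: "poly g l \<noteq> 0"
    using fin by (simp add: g_def poly_spectral_poly_eq_0_iff)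
  define h where "h = smult (n / poly g l) g"
  have "poly_mat h A *v x = weight_mat \<alpha> *v x" for x
  proof -
    have "poly_mat h A *v x = (n / poly g l * c x) *\<^sub>R \<alpha>"
      by (simp add: h_def poly_mat_smult c flip: scaleR_matrix_vector_assoc)
    also have "n / poly g l * c x = \<alpha> \<bullet> x"
      using cx[of x] g0 by (simp add: field_simps)
    also have "(\<alpha> \<bullet> x) *\<^sub>R \<alpha> = weight_mat \<alpha> *v x"
      by (simp add: vec_eq_iff weight_mat_def matrix_vector_mult_def inner_vec_def
          sum_distrib_left algebra_simps)
    finally show ?thesis .
  qed
  then have "poly_mat h A = weight_mat \<alpha>" by (simp add: matrix_eq)
  moreover have "degree h \<le> spec_d E"
    using card_eigvals_adj_mat[OF G P] fin lam
    by (simp add: h_def g_def degree_spectral_poly A_def)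
  ultimately show ?thesis using that by (simp add: A_def)
qed

section \<open>Predistance polynomials\<close>

lemma graph_inner_eq:
  "graph_inner E p q = (1 / real CARD('v)) * trace (poly_mat (p * q) (adj_mat E))"
  for E :: "'v::finite \<Rightarrow> 'v \<Rightarrow> bool"
  by (simp add: graph_inner_def poly_mat_mult)

lemma graph_inner_commute: "graph_inner E p q = graph_inner E q p"
  by (simp add: graph_inner_eq mult.commute)

lemma trace_scaleR: "trace (c *\<^sub>R M) = c * trace M" for M :: "real^'n^'n"
  by (simp add: trace_def sum_distrib_left)

lemma graph_inner_add_left: "graph_inner E (p + q) r = graph_inner E p r + graph_inner E q r"
  by (simp add: graph_inner_eq distrib_right poly_mat_add trace_add distrib_left)

lemma graph_inner_smult_left: "graph_inner E (smult c p) r = c * graph_inner E p r"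
  by (simp add: graph_inner_eq poly_mat_smult trace_scaleR)

lemma graph_inner_diff_left: "graph_inner E (p - q) r = graph_inner E p r - graph_inner E q r"
  by (simp add: graph_inner_eq left_diff_distrib poly_mat_diff trace_sub right_diff_distrib)

lemma graph_inner_0_left: "graph_inner E 0 r = 0"
  using graph_inner_smult_left[of E 0 0 r] by simp

lemma graph_inner_sum_left:
  "graph_inner E (\<Sum>i\<in>I. F i) r = (\<Sum>i\<in>I. graph_inner E (F i) r)"
  by (induction I rule: infinite_finite_induct)
     (simp_all add: graph_inner_0_left graph_inner_add_left)

text \<open>Multiplication by a fixed polynomial is self-adjoint. For a linear factor this is what makes the
  recurrence of orthogonal polynomials short.\<close>

lemma graph_inner_mult_left: "graph_inner E (r * p) q = graph_inner E p (r * q)"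
  by (simp add: graph_inner_eq ac_simps)

text \<open>On symmetric matrices the trace form is the sum of the squares of the entries. Equalities of norms
  therefore become statements about single entries.\<close>

lemma graph_inner_self:
  fixes E :: "'v::finite \<Rightarrow> 'v \<Rightarrow> bool"
  assumes "connected_simple_graph E"
  shows "real CARD('v) * graph_inner E q q
    = (\<Sum>u\<in>UNIV. \<Sum>v\<in>UNIV. (poly_mat q (adj_mat E) $ u $ v)\<^sup>2)"
  by (simp add: graph_inner_def trace_mult_symmetric transpose_poly_mat transpose_adj_mat assms)

lemma graph_inner_self_eq_0D:
  assumes "connected_simple_graph E" "graph_inner E q q = 0"
  shows "poly_mat q (adj_mat E) = 0"
  using graph_inner_self[OF assms(1), of q] assms(2)
  by (simp add: sum_nonneg_eq_0_iff sum_nonneg vec_eq_iff)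

text \<open>Each of the \<open>d + 1\<close> distinct eigenvalues would be a root of \<open>q\<close>. Together with the preceding
  lemma this makes the form positive definite on degree at most \<open>d\<close>.\<close>

lemma poly_mat_adj_mat_eq_0D:
  assumes G: "connected_simple_graph E" and P: "perron_vector E \<alpha>"
    and deg: "degree q \<le> spec_d E" and 0: "poly_mat q (adj_mat E) = 0"
  shows "q = 0"
proof (rule ccontr)
  assume q: "q \<noteq> 0"
  have "poly q l = 0" if "l \<in> eigvals (adj_mat E)" for l
  proof -
    from that obtain x where "x \<noteq> 0" "adj_mat E *v x = l *\<^sub>R x" by (auto simp: eigvals_def)
    with poly_mat_eigenvector[of "adj_mat E" x l q] 0 show ?thesis by simp
  qed
  then have "card (eigvals (adj_mat E)) \<le> card {x. poly q x = 0}"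
    by (intro card_mono poly_roots_finite q) auto
  also have "\<dots> \<le> degree q" by (rule card_poly_roots_bound[OF q])
  finally show False using deg card_eigvals_adj_mat[OF G P] by simp
qed

lemma degree_graded_basis_expansion:
  fixes p :: "nat \<Rightarrow> 'a::field poly"
  assumes "\<And>i. i \<le> k \<Longrightarrow> p i \<noteq> 0 \<and> degree (p i) = i" and "degree r \<le> k"
  shows "\<exists>c. r = (\<Sum>i\<le>k. smult (c i) (p i)) \<and> (degree r = k \<longrightarrow> r \<noteq> 0 \<longrightarrow> c k \<noteq> 0)"
  using assms
proof (induction k arbitrary: r)
  case 0
  then obtain a b where "p 0 = [:a:]" "r = [:b:]" "a \<noteq> 0"
    by (metis degree_eq_zeroE le_zero_eq pCons_0_0 order_refl)
  then show ?case by (intro exI[of _ "\<lambda>_. b / a"]) auto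
next
  case (Suc k)
  define a where "a = coeff r (Suc k) / lead_coeff (p (Suc k))"
  have p: "p (Suc k) \<noteq> 0" "degree (p (Suc k)) = Suc k" using Suc.prems by auto
  have "degree (r - smult a (p (Suc k))) \<le> k"
  proof (rule degree_le, intro allI impI)
    fix i assume "k < i"
    show "coeff (r - smult a (p (Suc k))) i = 0"
    proof (cases "i = Suc k")
      case True
      then show ?thesis using p by (simp add: a_def) (metis leading_coeff_0_iff)
    next
      case False
      with \<open>k < i\<close> have "Suc k < i" by simp
      then show ?thesis using p Suc.prems(2) by (simp add: coeff_eq_0)
    qed
  qed
  with Suc.IH[of "r - smult a (p (Suc k))"] Suc.prems obtain c where
    "r - smult a (p (Suc k)) = (\<Sum>i\<le>k. smult (c i) (p i))" by (metis le_SucI)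
  then have "r = (\<Sum>i\<le>Suc k. smult ((c(Suc k := a)) i) (p i))"
    by (simp add: algebra_simps)
  moreover have "(c(Suc k := a)) (Suc k) \<noteq> 0" if "degree r = Suc k" "r \<noteq> 0"
    using that p by (simp add: a_def) (metis leading_coeff_0_iff)
  ultimately show ?case by blast
qed

locale predistance_system =
  fixes E :: "'v::finite \<Rightarrow> 'v \<Rightarrow> bool"
    and \<alpha> :: "real^'v"
    and p :: "nat \<Rightarrow> real poly"
  assumes G: "connected_simple_graph E"
    and P: "perron_vector E \<alpha>"
    and pre: "predistance_polys E p"
begin

abbreviation "A \<equiv> adj_mat E"
abbreviation "d \<equiv> spec_d E"
abbreviation "ip \<equiv> graph_inner E"

lemma p_degree: "i \<le> d \<Longrightarrow> p i \<noteq> 0 \<and> degree (p i) = i"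
  and p_orthogonal: "i \<le> d \<Longrightarrow> j \<le> d \<Longrightarrow> i \<noteq> j \<Longrightarrow> ip (p i) (p j) = 0"
  and p_norm: "i \<le> d \<Longrightarrow> ip (p i) (p i) = poly (p i) (lambda0 E)"
  using pre by (auto simp: predistance_polys_def)

lemma p_norm_nonzero:
  assumes "i \<le> d"
  shows "ip (p i) (p i) \<noteq> 0"
proof
  assume "ip (p i) (p i) = 0"
  then have "poly_mat (p i) A = 0" by (rule graph_inner_self_eq_0D[OF G])
  with poly_mat_adj_mat_eq_0D[OF G P, of "p i"] p_degree[OF assms] assms show False by simp
qed

lemma p_inner_combination:
  assumes "k \<le> d" "j \<le> d"
  shows "ip (\<Sum>i\<le>k. smult (c i) (p i)) (p j) = (if j \<le> k then c j * ip (p j) (p j) else 0)"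
proof -
  have "ip (\<Sum>i\<le>k. smult (c i) (p i)) (p j)
      = (\<Sum>i\<le>k. if i = j then c j * ip (p j) (p j) else 0)"
    unfolding graph_inner_sum_left
    by (intro sum.cong) (use assms p_orthogonal in \<open>auto simp: graph_inner_smult_left\<close>)
  then show ?thesis by simp
qed

lemma p_expansion:
  assumes "degree r \<le> k" "k \<le> d"
  obtains c where "r = (\<Sum>i\<le>k. smult (c i) (p i))" "degree r = k \<Longrightarrow> r \<noteq> 0 \<Longrightarrow> c k \<noteq> 0"
  using degree_graded_basis_expansion[of k p r] p_degree assms by (auto dest: le_trans)

lemma p_inner_same_degree:
  assumes "degree r = i" "r \<noteq> 0" "i \<le> d"
  shows "ip r (p i) \<noteq> 0"
proof -
  obtain c where c: "r = (\<Sum>j\<le>i. smult (c j) (p j))"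
    and c_top: "degree r = i \<Longrightarrow> r \<noteq> 0 \<Longrightarrow> c i \<noteq> 0"
    by (rule p_expansion[OF eq_refl[OF assms(1)] assms(3)]) (blast intro: that)
  have "ip r (p i) = c i * ip (p i) (p i)"
    unfolding c using p_inner_combination[of i i c] assms(3) by simp
  moreover have "c i \<noteq> 0" by (rule c_top[OF assms(1,2)])
  ultimately show ?thesis using p_norm_nonzero[OF assms(3)] by simp
qed

definition head :: "nat \<Rightarrow> real poly" where
  "head k = (\<Sum>i<k. p i)"

definition tail :: "nat \<Rightarrow> real poly" where
  "tail k = (\<Sum>i=k..d. p i)"

lemma head_Suc: "head (Suc k) = head k + p k"
  by (simp add: head_def)

lemma tail_split: "k \<le> d \<Longrightarrow> tail k = p k + tail (Suc k)"
  by (simp add: tail_def sum.atLeast_Suc_atMost)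

lemma head_add_tail:
  assumes "k \<le> Suc d"
  shows "head k + tail k = head (Suc d)"
proof -
  have "{..<Suc d} = {..<k} \<union> {k..d}" using assms by auto
  moreover have "{..<k} \<inter> {k..d} = {}" by auto
  ultimately show ?thesis
    unfolding head_def tail_def
    by (simp only: sum.union_disjoint finite_lessThan finite_atLeastAtMost)
qed

lemma degree_head: "k \<le> d \<Longrightarrow> degree (head (Suc k)) \<le> k"
  unfolding head_def by (rule degree_sum_le) (use p_degree in auto)

text \<open>The initial sum of the \<open>p\<^sub>i\<close> is the reproducing kernel at \<open>\<lambda>\<^sub>0\<close> for polynomials of lower
  degree, because the normalisation \<open>\<parallel>p\<^sub>i\<parallel>\<^sup>2 = p\<^sub>i(\<lambda>\<^sub>0)\<close> turns Fourier coefficients into values.\<close>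

lemma head_inner:
  assumes "degree r < k" "k \<le> Suc d"
  shows "ip (head k) r = poly r (lambda0 E)"
proof -
  define m where "m = k - 1"
  have k: "k = Suc m" "m \<le> d" "degree r \<le> m" using assms by (auto simp: m_def)
  obtain c where r: "r = (\<Sum>i\<le>m. smult (c i) (p i))"
    using p_expansion k by blast
  have "ip (head k) r = (\<Sum>j<k. ip r (p j))"
    by (simp add: head_def graph_inner_sum_left graph_inner_commute[of E _ r])
  also have "\<dots> = (\<Sum>j\<le>m. c j * poly (p j) (lambda0 E))"
    unfolding k(1) lessThan_Suc_atMost r
    by (intro sum.cong) (use k p_inner_combination[of m] p_norm in auto)
  also have "\<dots> = poly r (lambda0 E)"
    by (simp add: r poly_sum)
  finally show ?thesis .
qed

text \<open>Any \<open>h\<close> with \<open>h(A) = \<alpha> \<alpha>\<^sup>T\<close> also represents evaluation at \<open>\<lambda>\<^sub>0\<close>, since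
  \<open>r(A) \<alpha> = r(\<lambda>\<^sub>0) \<alpha>\<close> and \<open>\<parallel>\<alpha>\<parallel>\<^sup>2 = n\<close>. So the full sum of the \<open>p\<^sub>i\<close> and the Hoffman polynomial
  differ by a polynomial orthogonal to itself.\<close>

lemma poly_mat_head_all: "poly_mat (head (Suc d)) A = weight_mat \<alpha>"
proof -
  obtain h where h: "degree h \<le> d" "poly_mat h A = weight_mat \<alpha>"
    using Hoffman_polynomial_exists[OF G P] .
  have h_inner: "ip h r = poly r (lambda0 E)" for r
    unfolding graph_inner_commute[of E h r]
    unfolding graph_inner_def h(2) poly_mat_mult_weight_mat[OF P]
    by (simp add: trace_scaleR trace_weight_mat perron_vectorD(3)[OF P])
  define f where "f = head (Suc d) - h"
  have "degree f \<le> d"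
    unfolding f_def by (intro degree_diff_le degree_head h) simp
  then have "ip f f = 0"
    using head_inner[of f "Suc d"] h_inner[of f]
    by (subst (1) f_def) (simp add: graph_inner_diff_left)
  then have "poly_mat f A = 0" by (rule graph_inner_self_eq_0D[OF G])
  then show ?thesis by (simp add: f_def poly_mat_diff h)
qed

lemma poly_mat_head_far:
  assumes "k \<le> gdist E u v" "k \<le> Suc d"
  shows "poly_mat (head k) A $ u $ v = 0"
proof (cases k)
  case 0
  then show ?thesis by (simp add: head_def)
next
  case (Suc m)
  with assms degree_head[of m] show ?thesis by (intro poly_mat_adj_mat_far) auto
qed

lemma poly_mat_tail:
  assumes "k \<le> Suc d"
  shows "poly_mat (tail k) A = weight_mat \<alpha> - poly_mat (head k) A"
  using head_add_tail[OF assms] poly_mat_head_all by (metis add_diff_cancel_left' poly_mat_add)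

text \<open>Where the head is invisible because of its degree, the tail must account for all of \<open>\<alpha> \<alpha>\<^sup>T\<close>.\<close>

lemma poly_mat_tail_far:
  assumes "k \<le> gdist E u v" "k \<le> Suc d"
  shows "poly_mat (tail k) A $ u $ v = \<alpha> $ u * \<alpha> $ v"
  by (simp add: poly_mat_tail poly_mat_head_far assms weight_mat_def)

subsection \<open>Descent of the support\<close>

text \<open>By the reproducing property, \<open>(x - \<lambda>\<^sub>0)(p\<^sub>0 + \<dots> + p\<^sub>i)\<close> is orthogonal to every \<open>p\<^sub>j\<close> with
  \<open>j < i\<close>: its inner product with \<open>p\<^sub>j\<close> is the value at \<open>\<lambda>\<^sub>0\<close> of \<open>(x - \<lambda>\<^sub>0) p\<^sub>j\<close>. For \<open>j = i\<close>
  the degree of that product is one too high for the kernel, and the defect is its inner product with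
  \<open>p\<^bsub>i+1\<^esub>\<close>, which is nonzero because the degrees agree.\<close>

lemma head_recurrence:
  assumes "i < d"
  obtains b c where "b \<noteq> 0"
    "[:- lambda0 E, 1:] * head (Suc i) = smult b (p i) + smult c (p (Suc i))"
proof -
  define x where "x = [:- lambda0 E, 1:]"
  define f where "f = x * head (Suc i)"
  have x: "degree x = 1" "x \<noteq> 0" "poly x (lambda0 E) = 0" by (simp_all add: x_def)
  have "degree f \<le> Suc i"
    using degree_mult_le[of x "head (Suc i)"] degree_head[of i] assms x by (simp add: f_def)
  then obtain c where c: "f = (\<Sum>j\<le>Suc i. smult (c j) (p j))"
    using p_expansion assms by (metis Suc_leI)
  have deg: "degree (x * p j) = Suc j" "x * p j \<noteq> 0" if "j \<le> d" for j
    using p_degree[OF that] x by (simp_all add: degree_mult_eq)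
  have cj: "c j * ip (p j) (p j) = ip (head (Suc i)) (x * p j)" if "j \<le> i" for j
  proof -
    have "ip f (p j) = c j * ip (p j) (p j)"
      unfolding c using p_inner_combination[of "Suc i" j c] that assms by auto
    then show ?thesis by (simp add: f_def graph_inner_mult_left)
  qed
  \<comment> \<open>Below \<open>i\<close>, the kernel of order \<open>i + 1\<close> evaluates a polynomial that vanishes at \<open>\<lambda>\<^sub>0\<close>.\<close>
  have "c j = 0" if "j < i" for j
  proof -
    have "ip (head (Suc i)) (x * p j) = 0"
      using head_inner[of "x * p j" "Suc i"] deg[of j] that assms x by simp
    with cj[of j] p_norm_nonzero[of j] that assms show ?thesis by simp
  qed
  then have f: "f = smult (c i) (p i) + smult (c (Suc i)) (p (Suc i))"
    unfolding c by (simp add: lessThan_Suc_atMost[symmetric])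
  \<comment> \<open>At \<open>i\<close> this needs the kernel of order \<open>i + 2\<close>, whose extra term contributes a nonzero value.\<close>
  have "ip (head (Suc (Suc i))) (x * p i) = 0"
    using head_inner[of "x * p i" "Suc (Suc i)"] deg[of i] assms x by simp
  moreover have "ip (p (Suc i)) (x * p i) \<noteq> 0"
    using p_inner_same_degree[of "x * p i" "Suc i"] deg[of i] assms
    by (simp add: graph_inner_commute)
  ultimately have "ip (head (Suc i)) (x * p i) \<noteq> 0"
    by (simp add: head_Suc[of "Suc i"] graph_inner_add_left)
  then have "c i \<noteq> 0" using cj[of i] by auto
  with f show ?thesis using that by (simp add: f_def x_def)
qed

text \<open>Since \<open>(A - \<lambda>\<^sub>0) \<alpha> \<alpha>\<^sup>T = 0\<close>, multiplying head and tail by \<open>A - \<lambda>\<^sub>0\<close> gives opposite matrices. The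
  tail's side is supported at distance at least \<open>i\<close>, and the head's side is a combination of
  \<open>p\<^sub>i(A)\<close> and \<open>p\<^bsub>i+1\<^esub>(A)\<close> by the recurrence. So \<open>p\<^sub>i(A)\<close> inherits the support.\<close>

lemma far_supported_descent:
  assumes i: "i < d"
    and tl: "far_supported E (Suc i) (poly_mat (tail (Suc i)) A)"
    and nxt: "far_supported E i (poly_mat (p (Suc i)) A)"
  shows "far_supported E i (poly_mat (p i) A)"
proof -
  define x where "x = [:- lambda0 E, 1:]"
  obtain b c where b: "b \<noteq> 0" and
    rec: "x * head (Suc i) = smult b (p i) + smult c (p (Suc i))"
    using head_recurrence[OF i] unfolding x_def .
  have "x * head (Suc d) = x * head (Suc i) + x * tail (Suc i)"
    using head_add_tail[of "Suc i"] i by (simp flip: distrib_left)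
  moreover have "poly_mat (x * head (Suc d)) A = 0"
    unfolding poly_mat_mult poly_mat_head_all poly_mat_mult_weight_mat[OF P]
    by (simp add: x_def)
  ultimately have "poly_mat (x * head (Suc i)) A + poly_mat (x * tail (Suc i)) A = 0"
    by (simp add: poly_mat_add)
  moreover have "poly_mat (x * tail (Suc i)) A
      = A ** poly_mat (tail (Suc i)) A - lambda0 E *\<^sub>R poly_mat (tail (Suc i)) A"
    by (simp add: x_def poly_mat_diff poly_mat_smult poly_mat_pCons)
  ultimately have "b *\<^sub>R poly_mat (p i) A = lambda0 E *\<^sub>R poly_mat (tail (Suc i)) A
      - A ** poly_mat (tail (Suc i)) A - c *\<^sub>R poly_mat (p (Suc i)) A"
    unfolding rec by (simp add: poly_mat_add poly_mat_smult algebra_simps)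
  moreover have "far_supported E i \<dots>"
    by (intro far_supported_diff far_supported_scaleR far_supported_adj_mat_mult G tl nxt
        far_supported_mono[OF tl]) simp
  ultimately show ?thesis using b by (metis far_supported_scaleR_iff)
qed

lemma delta_star_eq:
  "real CARD('v) * delta_star E \<alpha> k
    = (\<Sum>u\<in>UNIV. \<Sum>v\<in>UNIV. if gdist E u v = k then (\<alpha> $ u * \<alpha> $ v)\<^sup>2 else 0)"
proof -
  have rho: "rho \<alpha> U $ v = (if v \<in> U then \<alpha> $ v else 0)" for U v
    by (simp add: rho_def axis_def if_distrib[of "\<lambda>t. _ * t"] sum.delta cong: if_cong)
  have "(norm (rho \<alpha> (gsphere E k u)))\<^sup>2
      = (\<Sum>v\<in>UNIV. if gdist E u v = k then (\<alpha> $ v)\<^sup>2 else 0)" for u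
    unfolding power2_norm_eq_inner inner_vec_def
    by (intro sum.cong) (auto simp: rho gsphere_def power2_eq_square)
  then show ?thesis
    by (simp add: delta_star_def sum_distrib_left power_mult_distrib if_distrib cong: if_cong)
qed

text \<open>The pairs at distance \<open>k\<close> alone contribute \<open>n \<delta>\<^sup>*\<^sub>k\<close> to the squared norm of \<open>r(A)\<close>. If that
  is the whole norm, nothing is left for the other entries.\<close>

lemma poly_mat_eq_weight_on_sphere:
  assumes on: "\<And>u v. gdist E u v = k \<Longrightarrow> poly_mat r A $ u $ v = \<alpha> $ u * \<alpha> $ v"
    and norm: "ip r r = delta_star E \<alpha> k"
    and uv: "gdist E u v \<noteq> k"
  shows "poly_mat r A $ u $ v = 0"
proof -
  let ?off = "\<lambda>u v. if gdist E u v = k then 0 else (poly_mat r A $ u $ v)\<^sup>2"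
  have "(\<Sum>u\<in>UNIV. \<Sum>v\<in>UNIV. (poly_mat r A $ u $ v)\<^sup>2)
      = (\<Sum>u\<in>UNIV. \<Sum>v\<in>UNIV. (if gdist E u v = k then (\<alpha> $ u * \<alpha> $ v)\<^sup>2 else 0) + ?off u v)"
    by (intro sum.cong) (auto simp: on)
  then have "(\<Sum>u\<in>UNIV. \<Sum>v\<in>UNIV. ?off u v) = 0"
    using graph_inner_self[OF G, of r] norm delta_star_eq[of k] by (simp add: sum.distrib)
  then have "?off u v = 0"
    by (simp add: sum_nonneg_eq_0_iff sum_nonneg)
  then show ?thesis using uv by simp
qed

lemma tail_norm: "ip (tail k) (tail k) = poly (tail k) (lambda0 E)"
proof -
  have "ip (tail k) (tail k) = (\<Sum>i\<in>{k..d}. \<Sum>j\<in>{k..d}. ip (p j) (p i))"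
    unfolding tail_def graph_inner_sum_left
    by (subst graph_inner_commute) (simp add: graph_inner_sum_left)
  also have "\<dots> = (\<Sum>i\<in>{k..d}. \<Sum>j\<in>{k..d}. if j = i then poly (p i) (lambda0 E) else 0)"
    by (intro sum.cong) (auto simp: p_norm p_orthogonal)
  also have "\<dots> = poly (tail k) (lambda0 E)"
    by (simp add: tail_def poly_sum)
  finally show ?thesis .
qed

text \<open>For \<open>D > d\<close> the tail would be an empty sum, whereas \<open>\<delta>\<^sup>*\<^sub>D > 0\<close> because distance \<open>D\<close> occurs and
  \<open>\<alpha>\<close> is positive.\<close>

lemma gdiam_le_d:
  assumes "delta_star E \<alpha> (gdiam E) = poly (tail (gdiam E)) (lambda0 E)"
  shows "gdiam E \<le> d"
proof (rule ccontr)
  assume "\<not> gdiam E \<le> d"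
  then have "delta_star E \<alpha> (gdiam E) = 0" using assms by (simp add: tail_def)
  with delta_star_eq[of "gdiam E"] have
    "(\<Sum>u\<in>UNIV. \<Sum>v\<in>UNIV. if gdist E u v = gdiam E then (\<alpha> $ u * \<alpha> $ v)\<^sup>2 else 0) = 0"
    by simp
  then have "\<forall>u v. gdist E u v = gdiam E \<longrightarrow> \<alpha> $ u * \<alpha> $ v = 0"
    by (simp add: sum_nonneg_eq_0_iff sum_nonneg split: if_splits)
  then show False
    using gdiam_attained[of E] perron_vectorD(2)[OF P] by (metis less_irrefl mult_eq_0_iff)
qed

text \<open>The two equalities of norms give the supports of \<open>p\<^bsub>\<ge>D\<^esub>(A)\<close> and of \<open>p\<^bsub>D-1\<^esub>(A)\<close>. They are the start
  of the descent, which always needs the support of the next tail and of the next single polynomial.\<close>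

lemma tail_far_supported_all:
  assumes D1: "gdiam E \<ge> 1"
    and Dd: "gdiam E \<le> d"
    and last: "delta_star E \<alpha> (gdiam E) = poly (tail (gdiam E)) (lambda0 E)"
    and prev: "delta_star E \<alpha> (gdiam E - 1) = poly (p (gdiam E - 1)) (lambda0 E)"
    and k: "k \<le> gdiam E"
  shows "far_supported E k (poly_mat (tail k) A)"
proof -
  define m where "m = gdiam E - 1"
  have m: "gdiam E = Suc m" "m < d" using D1 Dd by (auto simp: m_def)
  have D: "far_supported E (Suc m) (poly_mat (tail (Suc m)) A)"
    unfolding far_supported_def
    using poly_mat_eq_weight_on_sphere[of "Suc m" "tail (Suc m)"] poly_mat_tail_far[of "Suc m"]
      tail_norm[of "Suc m"] last m by auto
  have eq: "poly_mat (p m) A $ u $ v = \<alpha> $ u * \<alpha> $ v" if "gdist E u v = m" for u v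
  proof -
    have "poly_mat (tail m) A $ u $ v = \<alpha> $ u * \<alpha> $ v"
      using that m by (intro poly_mat_tail_far) auto
    moreover have "poly_mat (tail (Suc m)) A $ u $ v = 0"
      using D that by (auto simp: far_supported_def)
    ultimately show ?thesis using tail_split[of m] m by (simp add: poly_mat_add)
  qed
  have pm: "far_supported E m (poly_mat (p m) A)"
    unfolding far_supported_def
    using poly_mat_eq_weight_on_sphere[OF eq] p_norm[of m] prev m by auto
  have tail: "far_supported E i (poly_mat (tail i) A)"
    if "i \<le> d" "far_supported E i (poly_mat (p i) A)"
      "far_supported E (Suc i) (poly_mat (tail (Suc i)) A)" for i
    using that tail_split[of i] far_supported_mono[OF that(3), of i]
    by (simp add: poly_mat_add far_supported_add)
  have "far_supported E i (poly_mat (p i) A) \<and> far_supported E i (poly_mat (tail i) A)"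
    if "i \<le> m" for i
    using that
  proof (induction rule: inc_induct)
    case base
    show ?case using pm tail[of m] D m by simp
  next
    case (step i)
    then have id: "i < d" using m by simp
    have "far_supported E i (poly_mat (p i) A)"
      using step.IH by (intro far_supported_descent id) (auto intro: far_supported_mono)
    with tail[of i] step.IH id show ?case by simp
  qed
  with D k m show ?thesis by (cases "k = Suc m") auto
qed

text \<open>If \<open>p\<^bsub>\<ge>1\<^esub>(A)\<close> has zero diagonal, then the constant \<open>p\<^sub>0\<close> accounts for all diagonal entries
  \<open>\<alpha>\<^sub>u\<^sup>2\<close> of \<open>\<alpha> \<alpha>\<^sup>T\<close>.\<close>

lemma perron_vector_constant:
  assumes tl: "far_supported E 1 (poly_mat (tail 1) A)"
  shows "\<alpha> $ u = 1"
proof -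
  obtain c where c: "p 0 = [:c:]"
    using p_degree[of 0] by (auto elim: degree_eq_zeroE)
  have sq: "(\<alpha> $ w)\<^sup>2 = c" for w
  proof -
    have "gdist E w w = 0" using gdist_eq_0_iff[OF G] by blast
    then have "poly_mat (tail 1) A $ w $ w = 0" "poly_mat (tail 0) A $ w $ w = \<alpha> $ w * \<alpha> $ w"
      using tl by (auto simp: far_supported_def poly_mat_tail_far)
    then have "poly_mat (p 0) A $ w $ w = \<alpha> $ w * \<alpha> $ w"
      using tail_split[of 0] by (simp add: poly_mat_add)
    then show ?thesis by (simp add: c poly_mat_pCons mat_def power2_eq_square)
  qed
  have "real CARD('v) = (\<Sum>w\<in>UNIV. (\<alpha> $ w)\<^sup>2)"
    using perron_vectorD(3)[OF P] by (simp add: inner_vec_def power2_eq_square)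
  also have "\<dots> = real CARD('v) * c" by (simp add: sq)
  finally have "c = 1" by simp
  then show ?thesis
    using sq[of u] perron_vectorD(2)[OF P, of u] by (simp add: power2_eq_1_iff)
qed

text \<open>By these supports, for constant \<open>\<alpha>\<close> the matrix of each tail \<open>p\<^bsub>\<ge>k\<^esub>\<close> is the indicator of distance at least \<open>k\<close>.
  The distance matrices are the differences of consecutive tails, and the last tail itself.\<close>

lemma distance_polynomialI:
  assumes Dd: "gdiam E \<le> d"
    and far: "\<And>k. k \<le> gdiam E \<Longrightarrow> far_supported E k (poly_mat (tail k) A)"
    and const: "\<And>u. \<alpha> $ u = 1"
  shows "distance_polynomial E"
  unfolding distance_polynomial_def
proof (intro allI impI)
  fix i assume i: "i \<le> gdiam E"
  have tail: "poly_mat (tail k) A $ u $ v = (if k \<le> gdist E u v then 1 else 0)"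
    if "k \<le> gdiam E" for k u v
    using far[OF that] poly_mat_tail_far[of k u v] that Dd const by (auto simp: far_supported_def)
  show "\<exists>q. dist_mat E i = poly_mat q A"
  proof (cases "i = gdiam E")
    case True
    have "dist_mat E i = poly_mat (tail i) A"
      using gdist_le_gdiam[of E] True
      by (auto simp: vec_eq_iff dist_mat_def tail intro: antisym)
    then show ?thesis ..
  next
    case False
    have "dist_mat E i = poly_mat (tail i - tail (Suc i)) A"
      using i False by (auto simp: vec_eq_iff dist_mat_def tail poly_mat_diff)
    then show ?thesis ..
  qed
qed

end

theorem theorem3p8:
  fixes E :: "'v::finite \<Rightarrow> 'v \<Rightarrow> bool"
    and \<alpha> :: "real^'v"
    and p :: "nat \<Rightarrow> real poly"
  assumes "connected_simple_graph E"
    and "gdiam E \<ge> 1"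
    and "perron_vector E \<alpha>"
    and "predistance_polys E p"
    and "delta_star E \<alpha> (gdiam E) = poly (\<Sum>i=gdiam E..spec_d E. p i) (lambda0 E)"
    and "delta_star E \<alpha> (gdiam E - 1) = poly (p (gdiam E - 1)) (lambda0 E)"
  shows "distance_polynomial E"
proof -
  interpret predistance_system E \<alpha> p
    using assms by unfold_locales
  note last = assms(5)[folded tail_def]
  have Dd: "gdiam E \<le> spec_d E" by (rule gdiam_le_d[OF last])
  note far = tail_far_supported_all[OF assms(2) Dd last assms(6)]
  have "\<alpha> $ u = 1" for u
    by (rule perron_vector_constant[OF far[OF assms(2)]])
  from distance_polynomialI[OF Dd far this] show ?thesis .
qed

end
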